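(* Let $(K,d_K)$ be a compact connected metric space and let $(L,d_L)$ be a metric space satisfying the following two conditions. (P1) $d_L(u,v)\ge 1$ for all distinct $u,v\in L$, and every bounded subset of $L$ is finite. (P2) For every nonexpansive bijection $h\colon\mathcal{K}(L)\to\mathcal{K}(L)$ there exist a bijective isometry $g\colon L\to L$ and nonempty finite sets $L_1\subseteq L_2\subseteq\cdots$ with $\bigcup_{n}L_n=L$ such that $h[\mathcal{K}(L_n)]=\mathcal{K}(g[L_n])$ for all $n\ge 1$. Then $\mathcal{K}(K\times L)$ is plastic, where $K\times L$ carries the supremum metric.
   Context: For a metric space $X$, $\mathcal{K}(X)$ is the set of all nonempty compact subsets of $X$ with the Hausdorff metric $d_H(A,B)=\max\{\sup_{a\in A}d(a,B),\sup_{b\in B}d(b,A)\}$. For $Y\subseteq X$, $\mathcal{K}(Y)$ is regarded as the subset of $\mathcal{K}(X)$ of those compact sets contained in $Y$. The supremum metric on $K\times L$ is $d((x,u),(y,v))=\max\{d_K(x,y),d_L(u,v)\}$. A map $f$ is nonexpansive if $d(f(x),f(y))\le d(x,y)$ for all $x,y$. A metric space is plastic if every bijective nonexpansive self-map is an isometry. $h[\cdot]$ and $g[\cdot]$ denote images of sets. *)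

theory Defs
  imports "HOL-Analysis.Analysis"
begin

text \<open>Metric spaces are given by a carrier and a distance function, as in the locale
  \<^locale>\<open>Metric_space\<close>; maps are total functions of which only the values on the
  carrier matter.\<close>

definition nonexpansive :: "'a set \<Rightarrow> ('a \<Rightarrow> 'a \<Rightarrow> real) \<Rightarrow> ('a \<Rightarrow> 'a) \<Rightarrow> bool" where
  "nonexpansive M d f \<longleftrightarrow> f \<in> M \<rightarrow> M \<and> (\<forall>x\<in>M. \<forall>y\<in>M. d (f x) (f y) \<le> d x y)"

definition isometry :: "'a set \<Rightarrow> ('a \<Rightarrow> 'a \<Rightarrow> real) \<Rightarrow> ('a \<Rightarrow> 'a) \<Rightarrow> bool" where
  "isometry M d f \<longleftrightarrow> f \<in> M \<rightarrow> M \<and> (\<forall>x\<in>M. \<forall>y\<in>M. d (f x) (f y) = d x y)"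

definition plastic :: "'a set \<Rightarrow> ('a \<Rightarrow> 'a \<Rightarrow> real) \<Rightarrow> bool" where
  "plastic M d \<longleftrightarrow> (\<forall>f. bij_betw f M M \<and> nonexpansive M d f \<longrightarrow> isometry M d f)"

text \<open>The library's \<^const>\<open>prod_dist\<close> is the Euclidean product metric, not the supremum metric.\<close>

definition sup_dist ::
    "('a \<Rightarrow> 'a \<Rightarrow> real) \<Rightarrow> ('b \<Rightarrow> 'b \<Rightarrow> real) \<Rightarrow> 'a \<times> 'b \<Rightarrow> 'a \<times> 'b \<Rightarrow> real" where
  "sup_dist d1 d2 = (\<lambda>(x, u) (y, v). max (d1 x y) (d2 u v))"

definition dist_to_set :: "('a \<Rightarrow> 'a \<Rightarrow> real) \<Rightarrow> 'a \<Rightarrow> 'a set \<Rightarrow> real" where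
  "dist_to_set d a B = (INF b\<in>B. d a b)"

text \<open>The infima and suprema are taken in \<^typ>\<open>real\<close>, so this is meaningful only for nonempty
  bounded sets, in particular on the hyperspace below.\<close>

definition hausdorff_dist :: "('a \<Rightarrow> 'a \<Rightarrow> real) \<Rightarrow> 'a set \<Rightarrow> 'a set \<Rightarrow> real" where
  "hausdorff_dist d A B = max (SUP a\<in>A. dist_to_set d a B) (SUP b\<in>B. dist_to_set d b A)"

definition hyperspace :: "'a set \<Rightarrow> ('a \<Rightarrow> 'a \<Rightarrow> real) \<Rightarrow> 'a set set" where
  "hyperspace M d = {A. A \<noteq> {} \<and> compactin (Metric_space.mtopology M d) A}"

definition hyperspace_of_subset :: "'a set \<Rightarrow> ('a \<Rightarrow> 'a \<Rightarrow> real) \<Rightarrow> 'a set \<Rightarrow> 'a set set" where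
  "hyperspace_of_subset M d Y = {A \<in> hyperspace M d. A \<subseteq> Y}"

end

theory Submission
  imports Defs
begin

text \<open>
  Compact subsets of \<open>L\<close> are finite, so every compact \<open>A \<subseteq> K \<times> L\<close> has a finite projection to \<open>L\<close>, and
  the hyperspace of \<open>K \<times> L\<close> splits into fibres, one for each nonempty finite \<open>F \<subseteq> L\<close>.  Sets at
  distance less than \<open>1\<close> have the same projection, so fibres are clopen; they are connected because
  \<open>K\<close> is (\<open>connectedin_fibre\<close>) and compact because the hyperspace of the compact \<open>K \<times> F\<close> is compact
  (\<open>compactin_hyperspace_of_subset\<close>).  The fibres are thus the components of the hyperspace.

  A nonexpansive bijection \<open>f\<close> maps components into components and so induces a map \<open>h\<close> of the
  hyperspace of \<open>L\<close>, which is nonexpansive and onto.  The critical point is that \<open>h\<close> is injective.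
  Continuity of \<open>f\<close> only gives that each fibre is partitioned into the images of the fibres that \<open>f\<close>
  maps into it.  These images are compact, and there are countably many of them since \<open>L\<close> is countable;
  Sierpinski's theorem (\<open>Sierpinski_countable_closed_partition\<close>), that a continuum has no partition
  into countably many and at least two nonempty closed sets, leaves room for one image only.

  The assumption on \<open>L\<close> now applies to \<open>h\<close> and yields, after composing \<open>f\<close> with the action of an
  isometry of \<open>L\<close>, arbitrarily large finite sets \<open>E \<subseteq> L\<close> such that the hyperspace of \<open>K \<times> E\<close> is mapped
  onto itself.  This hyperspace is compact, hence totally bounded, and a nonexpansive bijection of a
  totally bounded space is an isometry (\<open>nonexpansive_bij_isometric_if_mtotally_bounded\<close>).  As any two
  compact subsets of \<open>K \<times> L\<close> lie in a common \<open>K \<times> E\<close>, the map \<open>f\<close> is an isometry.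
\<close>

section \<open>The Hausdorff metric\<close>

context Metric_space
begin

lemma hyperspace_subset: "A \<in> hyperspace M d \<Longrightarrow> A \<subseteq> M"
  unfolding hyperspace_def using compactin_subset_topspace by fastforce

lemma hyperspace_nonempty: "A \<in> hyperspace M d \<Longrightarrow> A \<noteq> {}"
  by (simp add: hyperspace_def)

lemma finite_in_hyperspace: "finite A \<Longrightarrow> A \<noteq> {} \<Longrightarrow> A \<subseteq> M \<Longrightarrow> A \<in> hyperspace M d"
  by (simp add: hyperspace_def finite_imp_compactin)

lemma dist_to_set_le_iff:
  assumes "B \<in> hyperspace M d" "a \<in> M"
  shows "dist_to_set d a B \<le> r \<longleftrightarrow> (\<exists>b\<in>B. d a b \<le> r)"
proof -
  have B: "B \<subseteq> M" "B \<noteq> {}" "compactin mtopology B"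
    using assms hyperspace_subset by (auto simp: hyperspace_def)
  have "continuous_map mtopology euclidean (d a)"
  proof -
    have "\<exists>\<delta>>0. \<forall>x. x \<in> M \<and> d y x < \<delta> \<longrightarrow> dist (d a y) (d a x) < e"
      if "y \<in> M" "e > 0" for y e
    proof (intro exI[of _ e] conjI allI impI)
      fix x assume "x \<in> M \<and> d y x < e"
      moreover have "d a x \<le> d a y + d y x" "d a y \<le> d a x + d y x"
        using \<open>y \<in> M\<close> \<open>a \<in> M\<close> \<open>x \<in> M \<and> d y x < e\<close> triangle triangle' by auto
      ultimately show "dist (d a y) (d a x) < e"
        by (auto simp: dist_real_def)
    qed (use that in auto)
    then show ?thesis
      using metric_continuous_map[OF Met_TC.Metric_space_axioms, of "d a"] by simp
  qed
  then have "compact (d a ` B)"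
    using image_compactin[OF B(3)] by fastforce
  then obtain b where b: "b \<in> B" "\<And>c. c \<in> B \<Longrightarrow> d a b \<le> d a c"
    using compact_attains_inf[of "d a ` B"] B by auto
  have "dist_to_set d a B = d a b"
    unfolding dist_to_set_def by (rule cInf_eq_minimum) (use b in auto)
  then show ?thesis
    using b by (metis order_trans)
qed

text \<open>Since infima over compact sets are attained, the closed condition \<open>\<le> r\<close> on the Hausdorff
  distance unfolds to a first-order statement about points.  All later estimates go through this
  equivalence, so suprema and infima do not occur again.\<close>

lemma hausdorff_dist_le_iff:
  assumes A: "A \<in> hyperspace M d" and B: "B \<in> hyperspace M d"
  shows "hausdorff_dist d A B \<le> r \<longleftrightarrow>
    (\<forall>a\<in>A. \<exists>b\<in>B. d a b \<le> r) \<and> (\<forall>b\<in>B. \<exists>a\<in>A. d b a \<le> r)"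
proof -
  have one_side: "(SUP a\<in>A. dist_to_set d a B) \<le> r \<longleftrightarrow> (\<forall>a\<in>A. \<exists>b\<in>B. d a b \<le> r)"
    if A: "A \<in> hyperspace M d" and B: "B \<in> hyperspace M d" for A B
  proof -
    obtain b where b: "b \<in> B"
      using hyperspace_nonempty[OF B] by auto
    have sub: "A \<subseteq> M" "B \<subseteq> M"
      using A B hyperspace_subset by auto
    have "mbounded (insert b A)"
      using A sub b compactin_imp_mbounded by (auto simp: hyperspace_def mbounded_insert)
    then obtain C where C: "\<And>a. a \<in> A \<Longrightarrow> d a b \<le> C"
      unfolding mbounded_alt by blast
    have "bdd_above ((\<lambda>a. dist_to_set d a B) ` A)"
    proof (rule bdd_aboveI)
      fix t assume "t \<in> (\<lambda>a. dist_to_set d a B) ` A"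
      then show "t \<le> C"
        using C b sub dist_to_set_le_iff[OF B] by blast
    qed
    then have "(SUP a\<in>A. dist_to_set d a B) \<le> r \<longleftrightarrow> (\<forall>a\<in>A. dist_to_set d a B \<le> r)"
      by (rule cSUP_le_iff[OF hyperspace_nonempty[OF A]])
    then show ?thesis
      using dist_to_set_le_iff[OF B] sub(1) by (metis subsetD)
  qed
  show ?thesis
    unfolding hausdorff_dist_def using one_side[OF A B] one_side[OF B A] by auto
qed

text \<open>On sets that are empty or not compact \<^const>\<open>hausdorff_dist\<close> may have an unspecified
  value, whereas the locale \<^locale>\<open>Metric_space\<close> wants a nonnegative function on the
  whole type.  This variant is cut off to \<open>0\<close> there.\<close>

definition hyperdist :: "'a set \<Rightarrow> 'a set \<Rightarrow> real" where
  "hyperdist A B =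
    (if A \<in> hyperspace M d \<and> B \<in> hyperspace M d then hausdorff_dist d A B else 0)"

lemma hyperdist_eq [simp]:
  "A \<in> hyperspace M d \<Longrightarrow> B \<in> hyperspace M d \<Longrightarrow> hyperdist A B = hausdorff_dist d A B"
  by (simp add: hyperdist_def)

theorem Metric_space_hyperspace: "Metric_space (hyperspace M d) hyperdist"
proof -
  have comm: "hausdorff_dist d A B = hausdorff_dist d B A" for A B
    by (simp add: hausdorff_dist_def max.commute)
  have nonneg: "hausdorff_dist d A B \<ge> 0" if AB: "A \<in> hyperspace M d" "B \<in> hyperspace M d" for A B
  proof -
    obtain a where "a \<in> A"
      using hyperspace_nonempty[OF AB(1)] by blast
    then obtain b where "d a b \<le> hausdorff_dist d A B"
      using hausdorff_dist_le_iff[OF AB, of "hausdorff_dist d A B"] by auto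
    then show ?thesis
      using nonneg[of a b] by linarith
  qed
  have zero: "hausdorff_dist d A B = 0 \<longleftrightarrow> A = B"
    if AB: "A \<in> hyperspace M d" "B \<in> hyperspace M d" for A B
  proof
    assume "hausdorff_dist d A B = 0"
    then have le: "(\<forall>a\<in>A. \<exists>b\<in>B. d a b \<le> 0) \<and> (\<forall>b\<in>B. \<exists>a\<in>A. d b a \<le> 0)"
      using hausdorff_dist_le_iff[OF AB, of 0] by simp
    moreover have "x = y" if "x \<in> A \<union> B" "y \<in> A \<union> B" "d x y \<le> 0" for x y
    proof -
      have "x \<in> M" "y \<in> M"
        using that AB hyperspace_subset by auto
      then show ?thesis
        using that(3) mdist_pos_less not_le by blast
    qed
    ultimately show "A = B" by (metis UnI1 UnI2 subsetI subset_antisym)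
  next
    assume "A = B"
    moreover have "\<exists>b\<in>A. d a b \<le> 0" if "a \<in> A" for a
      using that subsetD[OF hyperspace_subset[OF AB(1)]] by (intro bexI[of _ a]) auto
    ultimately have "hausdorff_dist d A B \<le> 0"
      using hausdorff_dist_le_iff[OF AB, of 0] by simp
    with nonneg[OF AB] show "hausdorff_dist d A B = 0" by simp
  qed
  have tri: "hausdorff_dist d A C \<le> hausdorff_dist d A B + hausdorff_dist d B C"
    if A: "A \<in> hyperspace M d" and B: "B \<in> hyperspace M d" and C: "C \<in> hyperspace M d" for A B C
  proof -
    have chain: "\<exists>c\<in>C. d a c \<le> r + s"
      if sub: "A \<subseteq> M" "B \<subseteq> M" "C \<subseteq> M" and a: "a \<in> A"
        and AB: "\<forall>a\<in>A. \<exists>b\<in>B. d a b \<le> r" and BC: "\<forall>b\<in>B. \<exists>c\<in>C. d b c \<le> s"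
      for A B C a r s
    proof -
      obtain b c where bc: "b \<in> B" "c \<in> C" "d a b \<le> r" "d b c \<le> s"
        using AB BC a by meson
      moreover have "d a c \<le> d a b + d b c"
        using sub a bc(1,2) triangle by blast
      ultimately show ?thesis by force
    qed
    note sub = hyperspace_subset[OF A] hyperspace_subset[OF B] hyperspace_subset[OF C]
    have AB: "\<forall>a\<in>A. \<exists>b\<in>B. d a b \<le> hausdorff_dist d A B" "\<forall>b\<in>B. \<exists>a\<in>A. d b a \<le> hausdorff_dist d A B"
      using hausdorff_dist_le_iff[OF A B] by blast+
    have BC: "\<forall>a\<in>B. \<exists>b\<in>C. d a b \<le> hausdorff_dist d B C" "\<forall>b\<in>C. \<exists>a\<in>B. d b a \<le> hausdorff_dist d B C"
      using hausdorff_dist_le_iff[OF B C] by blast+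
    show ?thesis
      unfolding hausdorff_dist_le_iff[OF A C]
    proof (intro conjI ballI)
      show "\<exists>c\<in>C. d a c \<le> hausdorff_dist d A B + hausdorff_dist d B C" if "a \<in> A" for a
        by (rule chain[OF sub that AB(1) BC(1)])
      show "\<exists>a\<in>A. d c a \<le> hausdorff_dist d A B + hausdorff_dist d B C" if "c \<in> C" for c
        using chain[OF sub(3,2,1) that BC(2) AB(2)] by (simp only: add.commute)
    qed
  qed
  show ?thesis
    by (rule Metric_space.intro) (simp_all add: hyperdist_def comm nonneg zero tri)
qed

interpretation H: Metric_space "hyperspace M d" hyperdist
  by (rule Metric_space_hyperspace)

text \<open>The nonempty subsets of a finite net of \<open>S\<close> form a net of the hyperspace of \<open>S\<close>.\<close>

lemma hyperspace_mtotally_bounded: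
  assumes S: "compactin mtopology S"
  shows "H.mtotally_bounded (hyperspace_of_subset M d S)"
  unfolding H.mtotally_bounded_def
proof (intro allI impI)
  fix \<epsilon> :: real assume "\<epsilon> > 0"
  have SM: "S \<subseteq> M" using S compactin_subset_topspace by fastforce
  obtain N where N: "finite N" "N \<subseteq> S" "S \<subseteq> (\<Union>x\<in>N. mball x (\<epsilon>/2))"
    using compactin_imp_mtotally_bounded[OF S] \<open>\<epsilon> > 0\<close>
    unfolding mtotally_bounded_def by (meson half_gt_zero)
  let ?NN = "Pow N - {{}}"
  have NN: "?NN \<subseteq> hyperspace_of_subset M d S"
    using N SM by (auto simp: hyperspace_of_subset_def intro!: finite_in_hyperspace intro: finite_subset)
  have "A \<in> (\<Union>B\<in>?NN. H.mball B \<epsilon>)" if "A \<in> hyperspace_of_subset M d S" for A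
  proof -
    have A: "A \<in> hyperspace M d" "A \<subseteq> S"
      using that by (auto simp: hyperspace_of_subset_def)
    define B where "B = {x\<in>N. \<exists>a\<in>A. d x a < \<epsilon>/2}"
    have near: "\<exists>x\<in>B. d x a < \<epsilon>/2" if "a \<in> A" for a
      using that A(2) N(3) by (fastforce simp: B_def)
    then have "B \<noteq> {}" using hyperspace_nonempty[OF A(1)] by blast
    then have B: "B \<in> ?NN" by (auto simp: B_def)
    then have BH: "B \<in> hyperspace M d"
      using NN by (auto simp: hyperspace_of_subset_def)
    have "hausdorff_dist d B A \<le> \<epsilon>/2"
      unfolding hausdorff_dist_le_iff[OF BH A(1)]
    proof (intro conjI ballI)
      show "\<exists>a\<in>A. d x a \<le> \<epsilon>/2" if "x \<in> B" for x
        using that by (force simp: B_def)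
      show "\<exists>x\<in>B. d a x \<le> \<epsilon>/2" if "a \<in> A" for a
        using near[OF that] commute by (metis less_imp_le)
    qed
    then show ?thesis
      using B BH A(1) \<open>\<epsilon> > 0\<close> by (intro UN_I[of B]) auto
  qed
  then show "\<exists>K. finite K \<and> K \<subseteq> hyperspace_of_subset M d S \<and>
      hyperspace_of_subset M d S \<subseteq> (\<Union>B\<in>K. H.mball B \<epsilon>)"
    using N(1) NN by (intro exI[of _ ?NN]) auto
qed

text \<open>The limit of a Cauchy sequence of compact sets \<open>\<sigma> n\<close> is the set \<open>A\<close> of its cluster points,
  \<open>\<Inter>\<^sub>n cl (\<Union>\<^sub>m\<^sub>\<ge>\<^sub>n \<sigma> m)\<close>.  That \<open>A\<close> lies close to each late \<open>\<sigma> n\<close> is immediate.  Conversely a point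
  \<open>a\<close> of \<open>\<sigma> n\<close> has a nearby point in every later \<open>\<sigma> m\<close>, and by compactness of \<open>S\<close> these accumulate at
  a point of \<open>A\<close> close to \<open>a\<close>.\<close>

lemma hyperspace_Cauchy_converges:
  assumes S: "compactin mtopology S"
    and \<sigma>: "range \<sigma> \<subseteq> hyperspace_of_subset M d S" and Cauchy: "H.MCauchy \<sigma>"
  obtains A where "A \<in> hyperspace_of_subset M d S" "limitin H.mtopology \<sigma> A sequentially"
proof -
  have SM: "S \<subseteq> M" using S compactin_subset_topspace by fastforce
  have \<sigma>H: "\<sigma> n \<in> hyperspace M d" and \<sigma>S: "\<sigma> n \<subseteq> S" for n
    using \<sigma> by (auto simp: hyperspace_of_subset_def)
  have late: "\<exists>n0. \<forall>n\<ge>n0. \<forall>m\<ge>n0. \<forall>a\<in>\<sigma> n. \<exists>b\<in>\<sigma> m. d a b \<le> \<epsilon>" if eps: "\<epsilon> > 0" for \<epsilon>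
  proof -
    obtain n0 where "\<And>n m. n0 \<le> n \<Longrightarrow> n0 \<le> m \<Longrightarrow> hyperdist (\<sigma> n) (\<sigma> m) < \<epsilon>"
      using Cauchy eps unfolding H.MCauchy_def by meson
    then have "hausdorff_dist d (\<sigma> n) (\<sigma> m) \<le> \<epsilon>" if "n0 \<le> n" "n0 \<le> m" for n m
      using that hyperdist_eq[OF \<sigma>H \<sigma>H] by (metis less_imp_le)
    then show ?thesis
      unfolding hausdorff_dist_le_iff[OF \<sigma>H \<sigma>H] by meson
  qed
  define T where "T n = (\<Union>m\<in>{n..}. \<sigma> m)" for n
  have TS: "T n \<subseteq> S" for n using \<sigma>S by (auto simp: T_def)
  define A where "A = (\<Inter>n. mtopology closure_of T n)"
  have clS: "closedin mtopology S"
    using S Hausdorff_space_mtopology compactin_imp_closedin by blast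
  have AS: "A \<subseteq> S"
    using closure_of_minimal[OF TS clS, of 0] by (auto simp: A_def)
  have clA: "closedin mtopology A"
    unfolding A_def by (intro closedin_INT) auto
  have Anear: "\<exists>c\<in>A. d a c \<le> 2 * \<epsilon>"
    if n0: "\<forall>n\<ge>n0. \<forall>m\<ge>n0. \<forall>a\<in>\<sigma> n. \<exists>b\<in>\<sigma> m. d a b \<le> \<epsilon>"
      and eps: "\<epsilon> > 0" and n: "n \<ge> n0" and a: "a \<in> \<sigma> n" for n0 \<epsilon> n a
  proof -
    have "\<forall>m. \<exists>b\<in>\<sigma> (n0 + m). d a b \<le> \<epsilon>"
      using n0 n a by simp
    then obtain b where b: "\<And>m. b m \<in> \<sigma> (n0 + m)" "\<And>m. d a (b m) \<le> \<epsilon>"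
      by metis
    have "range b \<subseteq> S" using b(1) \<sigma>S by blast
    then obtain c r where c: "c \<in> S" "strict_mono (r :: nat \<Rightarrow> nat)"
      and lim: "limitin mtopology (b \<circ> r) c sequentially"
      using S unfolding compactin_sequentially by blast
    have close: "\<exists>N. \<forall>i\<ge>N. d (b (r i)) c < e" if "e > 0" for e
      using lim that unfolding limit_metric_sequentially comp_apply by meson
    have bM: "b m \<in> M" for m using b(1) \<sigma>S SM by blast
    have aM: "a \<in> M" using a \<sigma>S SM by blast
    have cM: "c \<in> M" using c SM by blast
    have "c \<in> mtopology closure_of T k" for k
      unfolding metric_closure_of
    proof (intro CollectI conjI allI impI cM)
      fix e :: real assume "e > 0"
      then obtain N where N: "\<forall>i\<ge>N. d (b (r i)) c < e" using close by blast
      let ?i = "max N k"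
      have "k \<le> n0 + r ?i"
        using seq_suble[OF c(2), of ?i] by linarith
      then have "b (r ?i) \<in> T k"
        using b(1)[of "r ?i"] by (auto simp: T_def)
      moreover have "b (r ?i) \<in> mball c e"
        using N bM cM commute by simp
      ultimately show "\<exists>y\<in>T k. y \<in> mball c e" by blast
    qed
    then have "c \<in> A" by (simp add: A_def)
    obtain i where "d (b (r i)) c < \<epsilon>" using close[OF eps] by blast
    then have "d a c \<le> 2 * \<epsilon>"
      using triangle[OF aM bM cM, of "r i"] b(2)[of "r i"] by linarith
    with \<open>c \<in> A\<close> show ?thesis by blast
  qed
  have \<sigma>near: "\<exists>b\<in>\<sigma> n. d a b \<le> 2 * \<epsilon>"
    if n0: "\<forall>n\<ge>n0. \<forall>m\<ge>n0. \<forall>a\<in>\<sigma> n. \<exists>b\<in>\<sigma> m. d a b \<le> \<epsilon>"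
      and eps: "\<epsilon> > 0" and n: "n \<ge> n0" and a: "a \<in> A" for n0 \<epsilon> n a
  proof -
    have "a \<in> mtopology closure_of T n0"
      using a by (auto simp: A_def)
    then obtain c where c: "c \<in> T n0" "c \<in> mball a \<epsilon>"
      using eps unfolding metric_closure_of by blast
    then obtain m where m: "m \<ge> n0" "c \<in> \<sigma> m" "d a c < \<epsilon>" and M: "a \<in> M" "c \<in> M"
      by (auto simp: T_def)
    then obtain b where b: "b \<in> \<sigma> n" "d c b \<le> \<epsilon>"
      using n0 n by blast
    then have "b \<in> M" using \<sigma>S SM by blast
    then have "d a b \<le> 2 * \<epsilon>"
      using triangle[OF M, of b] m(3) b(2) by linarith
    with b show ?thesis by blast
  qed
  have "A \<noteq> {}"
  proof -
    obtain n0 where n0: "\<forall>n\<ge>n0. \<forall>m\<ge>n0. \<forall>a\<in>\<sigma> n. \<exists>b\<in>\<sigma> m. d a b \<le> (1::real)"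
      using late[of 1] by auto
    obtain a where "a \<in> \<sigma> n0" using hyperspace_nonempty[OF \<sigma>H] by blast
    then show ?thesis using Anear[OF n0] by fastforce
  qed
  then have AH: "A \<in> hyperspace M d"
    using closed_compactin[OF S AS clA] by (simp add: hyperspace_def)
  have "limitin H.mtopology \<sigma> A sequentially"
    unfolding H.limit_metric_sequentially
  proof (intro conjI AH allI impI)
    fix \<epsilon> :: real assume "\<epsilon> > 0"
    then have "\<epsilon>/4 > 0" by simp
    then obtain n0 where n0: "\<forall>n\<ge>n0. \<forall>m\<ge>n0. \<forall>a\<in>\<sigma> n. \<exists>b\<in>\<sigma> m. d a b \<le> \<epsilon>/4"
      using late by blast
    have "hausdorff_dist d (\<sigma> n) A \<le> 2 * (\<epsilon>/4)" if "n \<ge> n0" for n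
      unfolding hausdorff_dist_le_iff[OF \<sigma>H AH]
      using Anear[OF n0 \<open>\<epsilon>/4 > 0\<close> that] \<sigma>near[OF n0 \<open>\<epsilon>/4 > 0\<close> that] by blast
    then have "\<forall>n\<ge>n0. \<sigma> n \<in> hyperspace M d \<and> hyperdist (\<sigma> n) A < \<epsilon>"
      using \<open>\<epsilon> > 0\<close> \<sigma>H AH by fastforce
    then show "\<exists>N. \<forall>n\<ge>N. \<sigma> n \<in> hyperspace M d \<and> hyperdist (\<sigma> n) A < \<epsilon>" ..
  qed
  with that AH AS show thesis by (simp add: hyperspace_of_subset_def)
qed

theorem compactin_hyperspace_of_subset:
  assumes S: "compactin mtopology S"
  shows "compactin H.mtopology (hyperspace_of_subset M d S)"
  unfolding H.compactin_sequentially
proof (intro conjI allI impI)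
  show "hyperspace_of_subset M d S \<subseteq> hyperspace M d"
    by (auto simp: hyperspace_of_subset_def)
  fix \<sigma> :: "nat \<Rightarrow> 'a set" assume \<sigma>: "range \<sigma> \<subseteq> hyperspace_of_subset M d S"
  then obtain r where r: "strict_mono (r :: nat \<Rightarrow> nat)" "H.MCauchy (\<sigma> \<circ> r)"
    using hyperspace_mtotally_bounded[OF S] unfolding H.mtotally_bounded_sequentially by blast
  moreover have "range (\<sigma> \<circ> r) \<subseteq> hyperspace_of_subset M d S"
    using \<sigma> by auto
  ultimately show "\<exists>A r. A \<in> hyperspace_of_subset M d S \<and> strict_mono r \<and>
      limitin H.mtopology (\<sigma> \<circ> r) A sequentially"
    using hyperspace_Cauchy_converges[OF S] by metis
qed

end

section \<open>Partitions of continua\<close>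

text \<open>One step of Sierpinski's construction.  If \<open>C\<close> meets \<open>F\<close>, take another member \<open>B\<close>
  that meets \<open>C\<close> and, inside \<open>C\<close>, a closed neighbourhood \<open>S\<close> of \<open>C \<inter> B\<close> that misses \<open>F\<close>.  The component \<open>D\<close> of \<open>S\<close> at a point of \<open>B\<close> reaches
  the frontier of \<open>S\<close> by boundary bumping, and no point of the frontier belongs to \<open>B\<close>; so \<open>D\<close>
  avoids \<open>F\<close> and still meets two members.\<close>

lemma subcontinuum_avoiding_member:
  assumes X: "compact_space X" "Hausdorff_space X"
    and closed: "\<forall>A\<in>\<F>. closedin X A"
    and disj: "pairwise disjnt \<F>" and cover: "topspace X \<subseteq> \<Union>\<F>"
    and C: "closedin X C" "connectedin X C"
    and two: "\<exists>A\<in>\<F>. \<exists>B\<in>\<F>. A \<noteq> B \<and> C \<inter> A \<noteq> {} \<and> C \<inter> B \<noteq> {}"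
    and F: "F \<in> \<F>"
  obtains D where "closedin X D" "connectedin X D" "D \<subseteq> C" "D \<inter> F = {}"
    "\<exists>A\<in>\<F>. \<exists>B\<in>\<F>. A \<noteq> B \<and> D \<inter> A \<noteq> {} \<and> D \<inter> B \<noteq> {}"
proof (cases "C \<inter> F = {}")
  case True
  then show thesis
    using that[of C] C two by simp
next
  case False
  obtain B where B: "B \<in> \<F>" "B \<noteq> F" "C \<inter> B \<noteq> {}"
    using two by metis
  then obtain x where x: "x \<in> C" "x \<in> B" by auto
  define Y where "Y = subtopology X C"
  have CX: "C \<subseteq> topspace X" using C(1) closedin_subset by blast
  have topY: "topspace Y = C"
    using CX by (auto simp: Y_def)
  have Y: "compact_space Y" "Hausdorff_space Y" "connected_space Y"
    using X C closedin_compact_space compact_space_subtopology Hausdorff_space_subtopology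
    by (auto simp: Y_def connectedin_def)
  have clY: "closedin Y (C \<inter> A)" if "A \<in> \<F>" for A
    unfolding Y_def using closedin_subtopology_Int_closed closed that by blast
  have "disjnt B F"
    using disj B(1,2) F by (simp add: pairwise_def)
  then have sub: "C \<inter> B \<subseteq> topspace Y - C \<inter> F"
    by (auto simp: disjnt_def topY)
  have op: "openin Y (topspace Y - C \<inter> F)"
    using clY[OF F] by blast
  have "normal_space Y"
    using Y compact_Hausdorff_or_regular_imp_normal_space by blast
  then obtain U where U: "openin Y U" "C \<inter> B \<subseteq> U" "Y closure_of U \<subseteq> topspace Y - C \<inter> F"
    unfolding normal_space_alt using clY[OF B(1)] op sub by meson
  define S where "S = Y closure_of U"
  have S: "closedin Y S" "S \<inter> F = {}" "S \<noteq> topspace Y" "S \<subseteq> C"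
  proof -
    show "closedin Y S" by (simp add: S_def)
    then show "S \<subseteq> C" using closedin_subset topY by blast
    then show "S \<inter> F = {}" using U(3) by (auto simp: S_def)
    then show "S \<noteq> topspace Y" using False topY by blast
  qed
  have US: "U \<subseteq> S"
    by (simp add: S_def closure_of_subset openin_subset[OF U(1)])
  have xS: "x \<in> S"
    using US U(2) x by blast
  define D where "D = connected_component_of_set (subtopology Y S) x"
  have xtop: "x \<in> topspace (subtopology Y S)"
    using xS x topY by simp
  then have Dcomp: "D \<in> connected_components_of (subtopology Y S)"
    unfolding D_def by (rule connected_component_in_connected_components_of[THEN iffD2])
  have xD: "x \<in> D"
    unfolding D_def using xtop connected_component_of_refl by fastforce
  have DS: "D \<subseteq> S"
    using connected_components_of_subset[OF Dcomp] by simp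
  have clD: "closedin X D"
    using closedin_connected_components_of[OF Dcomp] S(1) C(1)
    unfolding Y_def by (metis closedin_trans_full)
  have conD: "connectedin X D"
    using connectedin_connected_components_of[OF Dcomp]
    by (simp add: Y_def connectedin_subtopology)
  obtain y where y: "y \<in> D" "y \<in> Y frontier_of S"
    using boundary_bumping_theorem_closed[OF Y(3,1,2) S(1,3) Dcomp] by auto
  have "y \<notin> B"
  proof
    assume "y \<in> B"
    then have "y \<in> U" using y(1) DS S(4) U(2) by blast
    then have "y \<in> Y interior_of S"
      using interior_of_maximal[OF US U(1)] by blast
    with y(2) show False by (simp add: frontier_of_def)
  qed
  moreover obtain E where "E \<in> \<F>" "y \<in> E"
    using y(1) DS S(4) CX cover by blast
  ultimately have "\<exists>A\<in>\<F>. \<exists>B\<in>\<F>. A \<noteq> B \<and> D \<inter> A \<noteq> {} \<and> D \<inter> B \<noteq> {}"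
    using B(1) xD x(2) y(1) by blast
  then show thesis
    using that[of D] clD conD DS S(2,4) by blast
qed

text \<open>Iterating the step along an enumeration of the partition gives a decreasing sequence of
  nonempty compact sets.  A common point would avoid every member.\<close>

theorem Sierpinski_countable_closed_partition:
  assumes X: "compact_space X" "Hausdorff_space X" "connected_space X"
    and countable: "countable \<F>"
    and closed: "\<forall>A\<in>\<F>. closedin X A"
    and disj: "pairwise disjnt \<F>" and cover: "topspace X \<subseteq> \<Union>\<F>"
    and AB: "A \<in> \<F>" "B \<in> \<F>" "A \<noteq> {}" "B \<noteq> {}"
  shows "A = B"
proof (rule ccontr)
  assume "A \<noteq> B"
  define P where "P C \<longleftrightarrow> closedin X C \<and> connectedin X C \<and>
    (\<exists>A\<in>\<F>. \<exists>B\<in>\<F>. A \<noteq> B \<and> C \<inter> A \<noteq> {} \<and> C \<inter> B \<noteq> {})" for C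
  define e where "e = from_nat_into \<F>"
  have e: "range e = \<F>"
    unfolding e_def using countable AB(1) by (intro range_from_nat_into) auto
  have "\<exists>C. \<forall>n. P (C n) \<and> C (Suc n) \<subseteq> C n \<and> C (Suc n) \<inter> e n = {}"
  proof (rule dependent_nat_choice)
    have "A \<subseteq> topspace X" "B \<subseteq> topspace X"
      using closed AB closedin_subset by blast+
    then have "topspace X \<inter> A \<noteq> {}" "topspace X \<inter> B \<noteq> {}"
      using AB by auto
    then have "P (topspace X)"
      unfolding P_def using X(3) AB(1,2) \<open>A \<noteq> B\<close> by (auto simp: connectedin_topspace)
    then show "\<exists>C. P C" ..
  next
    fix C n assume "P C"
    then have C: "closedin X C" "connectedin X C"
      "\<exists>A\<in>\<F>. \<exists>B\<in>\<F>. A \<noteq> B \<and> C \<inter> A \<noteq> {} \<and> C \<inter> B \<noteq> {}"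
      by (auto simp: P_def)
    have en: "e n \<in> \<F>" using e by blast
    obtain D where "closedin X D" "connectedin X D" "D \<subseteq> C" "D \<inter> e n = {}"
      "\<exists>A\<in>\<F>. \<exists>B\<in>\<F>. A \<noteq> B \<and> D \<inter> A \<noteq> {} \<and> D \<inter> B \<noteq> {}"
      by (rule subcontinuum_avoiding_member[OF X(1,2) closed disj cover C en])
    then show "\<exists>D. P D \<and> D \<subseteq> C \<and> D \<inter> e n = {}"
      unfolding P_def by blast
  qed
  then obtain C where C: "\<And>n. P (C n)" "\<And>n. C (Suc n) \<subseteq> C n" "\<And>n. C (Suc n) \<inter> e n = {}"
    by blast
  have "\<Inter>(range C) \<noteq> {}"
  proof (rule compact_space_imp_nest[OF X(1)])
    show "closedin X (C n)" "C n \<noteq> {}" for n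
      using C(1)[of n] by (auto simp: P_def)
    show "decseq C"
      using C(2) by (simp add: decseq_SucI)
  qed
  then obtain z where z: "\<And>n. z \<in> C n" by auto
  moreover have "z \<in> topspace X"
    using z[of 0] C(1)[of 0] closedin_subset unfolding P_def by blast
  ultimately obtain n where "z \<in> e n"
    using cover e by blast
  then show False
    using C(3)[of n] z[of "Suc n"] by blast
qed

section \<open>Nonexpansive bijections of totally bounded sets\<close>

text \<open>Write \<open>g\<close> for the inverse of \<open>f\<close>, which does not decrease distances.  Total boundedness makes
  the orbits of \<open>x\<close> and \<open>y\<close> under \<open>g\<close> return: some \<open>g\<^sup>n x\<close>, \<open>g\<^sup>m x\<close> with \<open>n < m\<close> are close, and likewise
  for \<open>y\<close> with the same \<open>n\<close> and \<open>m\<close>.  Applying the nonexpansive \<open>f\<^sup>n\<close> shows that \<open>g\<^sup>m\<^sup>-\<^sup>n\<close> hardly moves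
  \<open>x\<close> and \<open>y\<close>; since distances grow along the orbits, \<open>d (g x) (g y)\<close> cannot exceed \<open>d x y\<close>.\<close>

lemma (in Metric_space) nonexpansive_bij_isometric_if_mtotally_bounded:
  assumes S: "mtotally_bounded S" and f: "bij_betw f S S"
    and le: "\<And>x y. x \<in> S \<Longrightarrow> y \<in> S \<Longrightarrow> d (f x) (f y) \<le> d x y"
    and xy: "x \<in> S" "y \<in> S"
  shows "d (f x) (f y) = d x y"
proof -
  have SM: "S \<subseteq> M" by (simp add: S mtotally_bounded_imp_subset)
  define g where "g = inv_into S f"
  have g: "bij_betw g S S" unfolding g_def using bij_betw_inv_into[OF f] .
  then have gS: "\<And>x. x \<in> S \<Longrightarrow> g x \<in> S" by (meson bij_betwE)
  have expand: "d x y \<le> d (g x) (g y)" if "x \<in> S" "y \<in> S" for x y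
    using le[OF gS[OF that(1)] gS[OF that(2)]] f that
    by (simp add: g_def bij_betw_inv_into_right)
  have orbit: "(g ^^ n) z \<in> S" if "z \<in> S" for n z
    using that by (induction n) (auto simp: gS)
  have grow: "d p q \<le> d ((g ^^ n) p) ((g ^^ n) q)" if "p \<in> S" "q \<in> S" for p q n
  proof (induction n)
    case (Suc n)
    then show ?case
      using expand[OF orbit[OF that(1)] orbit[OF that(2)], of n n] by simp
  qed simp
  have shrink: "d (g x) (g y) \<le> d x y" if xy: "x \<in> S" "y \<in> S" for x y
  proof (rule field_le_epsilon)
    fix \<epsilon> :: real assume "\<epsilon> > 0"
    define p where "p n = (g ^^ n) x" for n
    define q where "q n = (g ^^ n) y" for n
    have pq: "range p \<subseteq> S" "range q \<subseteq> S"
      unfolding p_def q_def using orbit xy by auto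
    obtain r where r: "strict_mono (r :: nat \<Rightarrow> nat)" "MCauchy (p \<circ> r)"
      using S pq(1) unfolding mtotally_bounded_sequentially by blast
    have "range (q \<circ> r) \<subseteq> S"
      using pq by auto
    then obtain s where s: "strict_mono (s :: nat \<Rightarrow> nat)" "MCauchy (q \<circ> r \<circ> s)"
      using S unfolding mtotally_bounded_sequentially by blast
    have "MCauchy (p \<circ> r \<circ> s)"
      using MCauchy_subsequence[OF s(1) r(2)] .
    then obtain N1 where N1: "\<And>i j. N1 \<le> i \<Longrightarrow> N1 \<le> j \<Longrightarrow> d (p (r (s i))) (p (r (s j))) < \<epsilon> / 2"
      unfolding MCauchy_def using \<open>\<epsilon> > 0\<close> by (metis comp_apply half_gt_zero)
    obtain N2 where N2: "\<And>i j. N2 \<le> i \<Longrightarrow> N2 \<le> j \<Longrightarrow> d (q (r (s i))) (q (r (s j))) < \<epsilon> / 2"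
      using s(2) unfolding MCauchy_def using \<open>\<epsilon> > 0\<close> by (metis comp_apply half_gt_zero)
    define i where "i = max N1 N2"
    define n where "n = r (s i)"
    obtain k where k: "r (s (Suc i)) = n + Suc k"
      using strict_monoD[OF r(1) strict_monoD[OF s(1) lessI[of i]]] unfolding n_def
      by (metis less_imp_Suc_add add_Suc_right)
    have closep: "d x ((g ^^ Suc k) x) < \<epsilon> / 2"
    proof -
      have "d x ((g ^^ Suc k) x) \<le> d ((g ^^ n) x) ((g ^^ n) ((g ^^ Suc k) x))"
        by (rule grow[OF xy(1) orbit[OF xy(1)]])
      also have "\<dots> = d (p (r (s i))) (p (r (s (Suc i))))"
        by (simp only: k p_def n_def [symmetric] funpow_add comp_apply)
      also have "\<dots> < \<epsilon> / 2"
        by (rule N1) (auto simp: i_def)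
      finally show ?thesis .
    qed
    have closeq: "d y ((g ^^ Suc k) y) < \<epsilon> / 2"
    proof -
      have "d y ((g ^^ Suc k) y) \<le> d ((g ^^ n) y) ((g ^^ n) ((g ^^ Suc k) y))"
        by (rule grow[OF xy(2) orbit[OF xy(2)]])
      also have "\<dots> = d (q (r (s i))) (q (r (s (Suc i))))"
        by (simp only: k q_def n_def [symmetric] funpow_add comp_apply)
      also have "\<dots> < \<epsilon> / 2"
        by (rule N2) (auto simp: i_def)
      finally show ?thesis .
    qed
    define x' where "x' = (g ^^ Suc k) x"
    define y' where "y' = (g ^^ Suc k) y"
    have M: "x \<in> M" "y \<in> M" "x' \<in> M" "y' \<in> M"
      unfolding x'_def y'_def using SM xy orbit by blast+
    have "d (g x) (g y) \<le> d x' y'"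
      unfolding x'_def y'_def funpow_Suc_right comp_apply by (rule grow) (use gS xy in auto)
    also have "\<dots> \<le> d x' x + d x y'"
      using triangle M by blast
    also have "\<dots> \<le> d x' x + (d x y + d y y')"
      using triangle M by simp
    also have "\<dots> \<le> d x y + \<epsilon>"
      using closep closeq commute[of x' x] unfolding x'_def y'_def by linarith
    finally show "d (g x) (g y) \<le> d x y + \<epsilon>" .
  qed
  have fS: "f x \<in> S" "f y \<in> S"
    using f xy by (auto dest: bij_betwE)
  have "d x y \<le> d (f x) (f y)"
    using shrink[OF fS] f xy by (simp add: g_def bij_betw_inv_into_left)
  then show ?thesis
    using le[OF xy] by simp
qed

section \<open>Fibres over the finite sets\<close>

lemma nonexpansive_imp_continuous_map:
  assumes "Metric_space M d" "Metric_space M' d'" "f \<in> M \<rightarrow> M'"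
    and le: "\<And>x y. x \<in> M \<Longrightarrow> y \<in> M \<Longrightarrow> d' (f x) (f y) \<le> d x y"
  shows "continuous_map (Metric_space.mtopology M d) (Metric_space.mtopology M' d') f"
proof -
  interpret Metric_space M d by fact
  show ?thesis
    unfolding metric_continuous_map[OF assms(2)]
  proof (intro conjI ballI allI impI)
    show "f ` M \<subseteq> M'" using assms(3) by auto
    fix a \<epsilon> assume "a \<in> M" "(\<epsilon>::real) > 0"
    then show "\<exists>\<delta>>0. \<forall>x. x \<in> M \<and> d a x < \<delta> \<longrightarrow> d' (f a) (f x) < \<epsilon>"
      using le by (intro exI[of _ \<epsilon>]) (meson order_le_less_trans)
  qed
qed

lemma sup_dist_eq: "sup_dist d1 d2 p q = max (d1 (fst p) (fst q)) (d2 (snd p) (snd q))"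
  by (simp add: sup_dist_def case_prod_beta)

lemma Metric_space_sup_dist:
  assumes "Metric_space M1 d1" "Metric_space M2 d2"
  shows "Metric_space (M1 \<times> M2) (sup_dist d1 d2)"
proof -
  interpret M1: Metric_space M1 d1 by fact
  interpret M2: Metric_space M2 d2 by fact
  show ?thesis
  proof
    show "0 \<le> sup_dist d1 d2 p q" for p q
      by (simp add: sup_dist_eq le_max_iff_disj)
    show "sup_dist d1 d2 p q = sup_dist d1 d2 q p" for p q
      by (simp add: sup_dist_eq M1.commute M2.commute)
    show "sup_dist d1 d2 p q = 0 \<longleftrightarrow> p = q" if "p \<in> M1 \<times> M2" "q \<in> M1 \<times> M2" for p q
    proof -
      have "sup_dist d1 d2 p q = 0 \<longleftrightarrow> d1 (fst p) (fst q) = 0 \<and> d2 (snd p) (snd q) = 0"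
        using M1.nonneg[of "fst p" "fst q"] M2.nonneg[of "snd p" "snd q"]
        unfolding sup_dist_eq by linarith
      then show ?thesis
        using that by (auto simp: prod_eq_iff)
    qed
    show "sup_dist d1 d2 p r \<le> sup_dist d1 d2 p q + sup_dist d1 d2 q r"
      if "p \<in> M1 \<times> M2" "q \<in> M1 \<times> M2" "r \<in> M1 \<times> M2" for p q r
    proof -
      have "d1 (fst p) (fst r) \<le> d1 (fst p) (fst q) + d1 (fst q) (fst r)"
        by (rule M1.triangle) (use that in auto)
      moreover have "d2 (snd p) (snd r) \<le> d2 (snd p) (snd q) + d2 (snd q) (snd r)"
        by (rule M2.triangle) (use that in auto)
      ultimately show ?thesis
        unfolding sup_dist_eq by linarith
    qed
  qed
qed

locale continuum_times_discrete =
  K: Metric_space K dK + L: Metric_space L dL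
  for K :: "'a set" and dK and L :: "'b set" and dL +
  assumes compact: "compact_space K.mtopology"
    and connected: "connected_space K.mtopology"
    and nonempty: "K \<noteq> {}"
    and separated: "\<And>u v. u \<in> L \<Longrightarrow> v \<in> L \<Longrightarrow> u \<noteq> v \<Longrightarrow> 1 \<le> dL u v"
    and bounded_finite: "\<And>S. L.mbounded S \<Longrightarrow> finite S"
begin

abbreviation D where "D \<equiv> sup_dist dK dL"
abbreviation HP where "HP \<equiv> hyperspace (K \<times> L) D"
abbreviation HL where "HL \<equiv> hyperspace L dL"

sublocale P: Metric_space "K \<times> L" D
  by (rule Metric_space_sup_dist) unfold_locales

sublocale HP: Metric_space HP P.hyperdist
  by (rule P.Metric_space_hyperspace)

lemma hyperspace_L_iff: "F \<in> HL \<longleftrightarrow> finite F \<and> F \<noteq> {} \<and> F \<subseteq> L"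
proof
  assume F: "F \<in> HL"
  then have "L.mbounded F"
    by (simp add: hyperspace_def L.compactin_imp_mbounded)
  then show "finite F \<and> F \<noteq> {} \<and> F \<subseteq> L"
    using bounded_finite L.hyperspace_nonempty[OF F] L.hyperspace_subset[OF F] by blast
qed (simp add: L.finite_in_hyperspace)

lemma countable_hyperspace_L: "countable HL"
proof -
  have "countable L"
  proof (cases "L = {}")
    case False
    then obtain u where u: "u \<in> L" by auto
    have "L \<subseteq> (\<Union>n::nat. L.mcball u (real n))"
      using u real_arch_simple by fastforce
    moreover have "countable (\<Union>n::nat. L.mcball u (real n))"
      using bounded_finite L.mbounded_mcball by (intro countable_UN) (auto intro: countable_finite)
    ultimately show ?thesis by (rule countable_subset)
  qed simp
  then have "countable {F. finite F \<and> F \<subseteq> L}"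
    by (rule countable_Collect_finite_subset)
  then show ?thesis
    by (rule countable_subset[rotated]) (auto simp: hyperspace_L_iff)
qed

lemma snd_image_in_hyperspace: "A \<in> HP \<Longrightarrow> snd ` A \<in> HL"
proof -
  assume A: "A \<in> HP"
  have "continuous_map P.mtopology L.mtopology snd"
    by (rule nonexpansive_imp_continuous_map[OF P.Metric_space_axioms L.Metric_space_axioms])
      (auto simp: sup_dist_eq)
  then have "compactin L.mtopology (snd ` A)"
    using A image_compactin unfolding hyperspace_def by blast
  then show ?thesis
    using A by (simp add: hyperspace_def)
qed

lemma hausdorff_dist_snd_image_le:
  assumes "A \<in> HP" "B \<in> HP"
  shows "hausdorff_dist dL (snd ` A) (snd ` B) \<le> hausdorff_dist D A B"
proof -
  have le: "(\<forall>p\<in>A. \<exists>q\<in>B. D p q \<le> hausdorff_dist D A B) \<and> (\<forall>q\<in>B. \<exists>p\<in>A. D q p \<le> hausdorff_dist D A B)"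
    using P.hausdorff_dist_le_iff[OF assms] by blast
  show ?thesis
    unfolding L.hausdorff_dist_le_iff[OF snd_image_in_hyperspace snd_image_in_hyperspace, OF assms]
  proof (intro conjI ballI)
    fix u assume "u \<in> snd ` A"
    then obtain p where p: "p \<in> A" "u = snd p" by auto
    then obtain q where "q \<in> B" "D p q \<le> hausdorff_dist D A B" using le by blast
    then show "\<exists>v\<in>snd ` B. dL u v \<le> hausdorff_dist D A B"
      by (intro bexI[of _ "snd q"]) (auto simp: p sup_dist_eq)
  next
    fix u assume "u \<in> snd ` B"
    then obtain p where p: "p \<in> B" "u = snd p" by auto
    then obtain q where "q \<in> A" "D p q \<le> hausdorff_dist D A B" using le by blast
    then show "\<exists>v\<in>snd ` A. dL u v \<le> hausdorff_dist D A B"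
      by (intro bexI[of _ "snd q"]) (auto simp: p sup_dist_eq)
  qed
qed

lemma section_in_hyperspace: "x \<in> K \<Longrightarrow> F \<in> HL \<Longrightarrow> {x} \<times> F \<in> HP"
  by (rule P.finite_in_hyperspace) (auto simp: hyperspace_L_iff)

lemma hausdorff_dist_section_le:
  assumes "x \<in> K" "F \<in> HL" "G \<in> HL"
  shows "hausdorff_dist D ({x} \<times> F) ({x} \<times> G) \<le> hausdorff_dist dL F G"
proof -
  have "(\<forall>u\<in>F. \<exists>v\<in>G. dL u v \<le> hausdorff_dist dL F G) \<and> (\<forall>v\<in>G. \<exists>u\<in>F. dL v u \<le> hausdorff_dist dL F G)"
    using L.hausdorff_dist_le_iff[OF assms(2,3)] by blast
  then show ?thesis
    unfolding P.hausdorff_dist_le_iff[OF section_in_hyperspace section_in_hyperspace, OF assms(1,2,1,3)]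
    using assms(1) by (auto simp: sup_dist_eq intro: order_trans[OF L.nonneg])
qed

text \<open>Because distinct points of \<open>L\<close> have distance at least \<open>1\<close>, the projection to \<open>L\<close> is locally
  constant on the hyperspace of the product.  Hence its fibres are clopen.\<close>

lemma snd_image_eq_if_hausdorff_dist_less_1:
  assumes A: "A \<in> HP" and B: "B \<in> HP" and less: "hausdorff_dist D A B < 1"
  shows "snd ` A = snd ` B"
proof -
  have H: "snd ` A \<in> HL" "snd ` B \<in> HL"
    using A B snd_image_in_hyperspace by auto
  define r where "r = hausdorff_dist dL (snd ` A) (snd ` B)"
  have "r < 1"
    using hausdorff_dist_snd_image_le[OF A B] less by (simp add: r_def)
  have near: "(\<forall>u\<in>snd ` A. \<exists>v\<in>snd ` B. dL u v \<le> r) \<and> (\<forall>v\<in>snd ` B. \<exists>u\<in>snd ` A. dL v u \<le> r)"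
    unfolding L.hausdorff_dist_le_iff[OF H, symmetric] by (simp add: r_def)
  have subset: "F \<subseteq> G" if "F \<in> HL" "G \<in> HL" "\<forall>u\<in>F. \<exists>v\<in>G. dL u v \<le> r" for F G
  proof
    fix u assume "u \<in> F"
    then obtain v where v: "v \<in> G" "dL u v \<le> r" using \<open>\<forall>u\<in>F. \<exists>v\<in>G. dL u v \<le> r\<close> by blast
    have "u \<in> L" "v \<in> L"
      using \<open>u \<in> F\<close> v(1) L.hyperspace_subset[OF \<open>F \<in> HL\<close>] L.hyperspace_subset[OF \<open>G \<in> HL\<close>] by auto
    then have "u = v" using separated[of u v] v(2) \<open>r < 1\<close> by fastforce
    then show "u \<in> G" using v(1) by simp
  qed
  show ?thesis
    using subset[OF H conjunct1[OF near]] subset[OF H(2,1) conjunct2[OF near]] by (rule subset_antisym)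
qed

definition fibre :: "'b set \<Rightarrow> ('a \<times> 'b) set set" where
  "fibre F = {A \<in> HP. snd ` A = F}"

lemma fibre_subset: "fibre F \<subseteq> HP"
  by (auto simp: fibre_def)

lemma fibre_imp_subset_Times:
  assumes "A \<in> fibre F"
  shows "A \<subseteq> K \<times> F"
proof
  fix p assume "p \<in> A"
  moreover have "A \<subseteq> K \<times> L" "snd ` A = F"
    using assms P.hyperspace_subset by (auto simp: fibre_def)
  ultimately have "fst p \<in> K" "snd p \<in> F" by auto
  then show "p \<in> K \<times> F" by (simp add: mem_Times_iff)
qed

lemma openin_Union_fibres: "openin HP.mtopology {A \<in> HP. snd ` A \<in> \<A>}"
  unfolding HP.openin_mtopology
proof (intro conjI allI impI)
  fix A assume A: "A \<in> {A \<in> HP. snd ` A \<in> \<A>}"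
  then have "HP.mball A 1 \<subseteq> {A \<in> HP. snd ` A \<in> \<A>}"
    using snd_image_eq_if_hausdorff_dist_less_1[of A] by auto
  then show "\<exists>r>0. HP.mball A r \<subseteq> {A \<in> HP. snd ` A \<in> \<A>}"
    by (intro exI[of _ 1]) simp
qed auto

lemma openin_fibre: "openin HP.mtopology (fibre F)"
  using openin_Union_fibres[of "{F}"] by (simp add: fibre_def)

lemma closedin_fibre: "closedin HP.mtopology (fibre F)"
proof -
  have "HP - fibre F = {A \<in> HP. snd ` A \<in> - {F}}"
    by (auto simp: fibre_def)
  then show ?thesis
    using openin_Union_fibres[of "- {F}"] fibre_subset by (simp add: closedin_def)
qed

lemma compactin_Times_finite:
  assumes "finite F" "F \<subseteq> L"
  shows "compactin P.mtopology (K \<times> F)"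
proof -
  have "compactin P.mtopology ((\<lambda>x. (x, u)) ` K)" if "u \<in> F" for u
  proof (rule image_compactin)
    show "compactin K.mtopology K"
      using compact by (simp add: compact_space_def)
    show "continuous_map K.mtopology P.mtopology (\<lambda>x. (x, u))"
      by (rule nonexpansive_imp_continuous_map[OF K.Metric_space_axioms P.Metric_space_axioms])
        (use that assms in \<open>auto simp: sup_dist_eq\<close>)
  qed
  then have "compactin P.mtopology (\<Union>u\<in>F. (\<lambda>x. (x, u)) ` K)"
    using assms by (intro compactin_Union) auto
  moreover have "(\<Union>u\<in>F. (\<lambda>x. (x, u)) ` K) = K \<times> F"
    by auto
  ultimately show ?thesis by simp
qed

lemma compactin_fibre:
  assumes "F \<in> HL"
  shows "compactin HP.mtopology (fibre F)"
proof (rule closed_compactin)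
  show "compactin HP.mtopology (hyperspace_of_subset (K \<times> L) D (K \<times> F))"
    using assms by (intro P.compactin_hyperspace_of_subset compactin_Times_finite)
      (auto simp: hyperspace_L_iff)
  show "fibre F \<subseteq> hyperspace_of_subset (K \<times> L) D (K \<times> F)"
    using fibre_imp_subset_Times by (auto simp: fibre_def hyperspace_of_subset_def)
qed (rule closedin_fibre)

lemma section_in_fibre: "x \<in> K \<Longrightarrow> F \<in> HL \<Longrightarrow> {x} \<times> F \<in> fibre F"
  using section_in_hyperspace by (force simp: fibre_def)

lemma fibre_nonempty: "F \<in> HL \<Longrightarrow> fibre F \<noteq> {}"
  using section_in_fibre nonempty by blast

text \<open>A finite set \<open>S\<close> in the fibre of \<open>F\<close> contains some \<open>(y, u)\<close>, so moving the point \<open>(z, u)\<close>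
  of \<open>insert (z, u) S\<close> with \<open>z\<close> from \<open>y\<close> to \<open>x\<close> gives a connected set joining \<open>S\<close> to \<open>insert (x, u) S\<close>.\<close>

lemma connected_component_of_insert:
  assumes S: "S \<in> fibre F" "finite S" and xu: "x \<in> K" "u \<in> F"
  shows "connected_component_of (subtopology HP.mtopology (fibre F)) S (insert (x, u) S)"
proof -
  have SP: "S \<subseteq> K \<times> L" and F: "snd ` S = F"
    using S(1) P.hyperspace_subset by (auto simp: fibre_def)
  obtain y where y: "(y, u) \<in> S" using xu F by auto
  then have "u \<in> L" "y \<in> K" using SP by auto
  have ins: "insert (z, u) S \<in> HP" if "z \<in> K" for z
    using that \<open>u \<in> L\<close> S SP by (intro P.finite_in_hyperspace) auto
  have "continuous_map K.mtopology HP.mtopology (\<lambda>z. insert (z, u) S)"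
  proof (rule nonexpansive_imp_continuous_map[OF K.Metric_space_axioms HP.Metric_space_axioms])
    fix z w assume zw: "z \<in> K" "w \<in> K"
    have move: "\<exists>q\<in>insert (b, u) S. D p q \<le> dK a b"
      if "p \<in> insert (a, u) S" "a \<in> K" "b \<in> K" for p a b
    proof (cases "p \<in> S")
      case True
      then have "D p p \<le> dK a b" using SP by (metis P.mdist_zero K.nonneg subsetD)
      with True show ?thesis by blast
    next
      case False
      then have "D p (b, u) \<le> dK a b"
        using that \<open>u \<in> L\<close> by (simp add: sup_dist_eq)
      then show ?thesis by blast
    qed
    have "hausdorff_dist D (insert (z, u) S) (insert (w, u) S) \<le> dK z w"
      unfolding P.hausdorff_dist_le_iff[OF ins ins, OF zw]
    proof (intro conjI ballI)
      show "\<exists>q\<in>insert (w, u) S. D p q \<le> dK z w" if "p \<in> insert (z, u) S" for p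
        by (rule move[OF that zw])
      show "\<exists>q\<in>insert (z, u) S. D p q \<le> dK z w" if "p \<in> insert (w, u) S" for p
        using move[OF that zw(2,1)] by (simp only: K.commute[of z w])
    qed
    then show "P.hyperdist (insert (z, u) S) (insert (w, u) S) \<le> dK z w"
      using ins zw by simp
  qed (use ins in auto)
  then have con: "connectedin HP.mtopology ((\<lambda>z. insert (z, u) S) ` K)"
  proof (rule connectedin_continuous_map_image)
    show "connectedin K.mtopology K"
      using connected by (metis K.topspace_mtopology connectedin_topspace)
  qed
  have "(\<lambda>z. insert (z, u) S) ` K \<subseteq> fibre F"
  proof (rule image_subsetI)
    fix z assume "z \<in> K"
    then show "insert (z, u) S \<in> fibre F"
      using ins F xu(2) by (simp add: fibre_def insert_absorb)
  qed
  with con have "connectedin (subtopology HP.mtopology (fibre F)) ((\<lambda>z. insert (z, u) S) ` K)"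
    by (simp add: connectedin_subtopology)
  moreover have "S \<in> (\<lambda>z. insert (z, u) S) ` K"
    by (rule image_eqI[OF _ \<open>y \<in> K\<close>]) (simp add: insert_absorb y)
  ultimately show ?thesis
    unfolding connected_component_of_def using xu by blast
qed

lemma connected_component_of_finite:
  assumes S: "S \<in> fibre F" "finite S" and T: "T \<in> fibre F" "finite T"
  shows "connected_component_of (subtopology HP.mtopology (fibre F)) S T"
proof -
  let ?Y = "subtopology HP.mtopology (fibre F)"
  have union: "connected_component_of ?Y S (S \<union> T)"
    if S: "S \<in> fibre F" "finite S" and T: "T \<subseteq> K \<times> F" "finite T" for S T
    using T(2,1)
  proof (induction T rule: finite_induct)
    case empty
    then show ?case
      using S fibre_subset by (auto simp: connected_component_of_refl)
  next
    case (insert p T)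
    then have *: "connected_component_of ?Y S (S \<union> T)" "p \<in> K \<times> F" by auto
    then have "S \<union> T \<in> fibre F"
      using connected_component_in_topspace by fastforce
    then have "connected_component_of ?Y (S \<union> T) (insert p (S \<union> T))"
      using connected_component_of_insert[of "S \<union> T" F "fst p" "snd p"] *(2) S(2) insert(1) by auto
    then show ?case
      using *(1) connected_component_of_trans by fastforce
  qed
  have sub: "S \<subseteq> K \<times> F" "T \<subseteq> K \<times> F"
    using S(1) T(1) fibre_imp_subset_Times by auto
  have "connected_component_of ?Y S (S \<union> T)"
    by (rule union[OF S sub(2) T(2)])
  moreover have "connected_component_of ?Y T (S \<union> T)"
    using union[OF T sub(1) S(2)] by (simp add: Un_commute)
  ultimately show ?thesis
    using connected_component_of_trans[of ?Y S "S \<union> T" T] connected_component_of_sym[of ?Y] by blast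
qed

text \<open>The finite members of a fibre lie in one component of it, and they are dense.\<close>

lemma connectedin_fibre:
  assumes F: "F \<in> HL"
  shows "connectedin HP.mtopology (fibre F)"
proof -
  let ?Y = "subtopology HP.mtopology (fibre F)"
  obtain x0 where x0: "x0 \<in> K" using nonempty by auto
  define S0 where "S0 = {x0} \<times> F"
  have S0: "S0 \<in> fibre F" "finite S0"
    using section_in_fibre[OF x0 F] F by (auto simp: S0_def hyperspace_L_iff)
  define C where "C = connected_component_of_set ?Y S0"
  have "closedin HP.mtopology C"
    unfolding C_def using closedin_connected_component_of closedin_fibre closedin_trans_full by metis
  have "fibre F \<subseteq> C"
  proof
    fix A assume A: "A \<in> fibre F"
    then have AH: "A \<in> HP" by (simp add: fibre_def)
    show "A \<in> C"
    proof (rule ccontr)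
      assume "A \<notin> C"
      then obtain r where r: "r > 0" "disjnt C (HP.mball A r)"
        using \<open>closedin HP.mtopology C\<close> AH unfolding HP.closedin_metric by blast
      (* The bound r puts an approximating set into the ball, the bound 1 keeps it in the fibre. *)
      define \<epsilon> where "\<epsilon> = min r 1 / 2"
      have \<epsilon>: "0 < \<epsilon>" "\<epsilon> < r" "\<epsilon> < 1" using r by (auto simp: \<epsilon>_def)
      have "P.mtotally_bounded A"
        using AH P.compactin_imp_mtotally_bounded by (simp add: hyperspace_def)
      then have "\<exists>S. finite S \<and> S \<subseteq> A \<and> A \<subseteq> (\<Union>p\<in>S. P.mball p \<epsilon>)"
        using \<epsilon>(1) by (simp add: P.mtotally_bounded_def)
      then obtain S where S: "finite S" "S \<subseteq> A" "A \<subseteq> (\<Union>p\<in>S. P.mball p \<epsilon>)"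
        by blast
      then have "S \<noteq> {}" using P.hyperspace_nonempty[OF AH] by auto
      then have SH: "S \<in> HP"
        using S P.hyperspace_subset[OF AH] by (intro P.finite_in_hyperspace) auto
      have near: "\<exists>q\<in>S. D p q \<le> \<epsilon>" if "p \<in> A" for p
      proof -
        obtain q where "q \<in> S" "D q p < \<epsilon>"
          using S(3) \<open>p \<in> A\<close> by auto
        then show ?thesis using P.commute less_imp_le by metis
      qed
      have le: "hausdorff_dist D A S \<le> \<epsilon>"
        unfolding P.hausdorff_dist_le_iff[OF AH SH]
      proof (intro conjI ballI near)
        fix q assume "q \<in> S"
        then have "q \<in> A" "D q q \<le> \<epsilon>"
          using S(2) P.hyperspace_subset[OF AH] \<epsilon>(1) P.mdist_zero by (metis less_imp_le subsetD)+
        then show "\<exists>p\<in>A. D q p \<le> \<epsilon>" by blast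
      qed
      then have "snd ` S = snd ` A"
        using snd_image_eq_if_hausdorff_dist_less_1[OF AH SH] \<epsilon>(3) by simp
      then have "S \<in> fibre F" using SH A by (simp add: fibre_def)
      then have "S \<in> C"
        using connected_component_of_finite[OF S0] S(1) by (simp add: C_def)
      moreover have "S \<in> HP.mball A r"
        using AH SH le \<epsilon>(2) by simp
      ultimately show False using r(2) by (auto simp: disjnt_def)
    qed
  qed
  moreover have "connectedin ?Y C"
    unfolding C_def by (rule connectedin_connected_component_of)
  ultimately show ?thesis
    by (metis connectedin_subtopology subset_antisym)
qed

section \<open>Plasticity of the hyperspace of the product\<close>

text \<open>A nonexpansive bijection \<open>f\<close> of the hyperspace of \<open>K \<times> L\<close> carries fibres into fibres because
  fibres are connected and clopen; this is the map \<open>h\<close>.  It is nonexpansive since projection to \<open>L\<close>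
  does not increase Hausdorff distances while the sections \<open>{x} \<times> F\<close> realise the distances of \<open>L\<close>,
  and onto since \<open>f\<close> is.  If \<open>h\<close> were not injective, then the images of the fibres mapped into one
  fibre would form a countable partition of this continuum into several nonempty compact sets,
  against Sierpinski's theorem.\<close>

lemma nonexpansive_bij_induces_base_bij:
  assumes bij: "bij_betw f HP HP" and ne: "nonexpansive HP (hausdorff_dist D) f"
  obtains h where "bij_betw h HL HL" "nonexpansive HL (hausdorff_dist dL) h"
    "\<And>A. A \<in> HP \<Longrightarrow> snd ` f A = h (snd ` A)"
proof -
  obtain x0 where x0: "x0 \<in> K" using nonempty by auto
  define h where "h F = snd ` f ({x0} \<times> F)" for F
  have fHP: "f A \<in> HP" if "A \<in> HP" for A
    using bij that by (auto dest: bij_betwE)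
  have f_le: "hausdorff_dist D (f A) (f B) \<le> hausdorff_dist D A B" if "A \<in> HP" "B \<in> HP" for A B
    using ne that by (simp add: nonexpansive_def)
  have contf: "continuous_map HP.mtopology HP.mtopology f"
    by (rule nonexpansive_imp_continuous_map[OF HP.Metric_space_axioms HP.Metric_space_axioms])
      (use fHP f_le in auto)
  have image_fibre: "f ` fibre F \<subseteq> fibre (h F)" if F: "F \<in> HL" for F
  proof -
    have S0: "{x0} \<times> F \<in> fibre F" by (rule section_in_fibre[OF x0 F])
    then have "{x0} \<times> F \<in> HP" using fibre_subset by blast
    then have "f ({x0} \<times> F) \<in> fibre (h F)"
      using fHP by (simp add: fibre_def h_def)
    then have "\<not> disjnt (f ` fibre F) (fibre (h F))"
      using S0 by (auto simp: disjnt_def)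
    moreover have "connectedin HP.mtopology (f ` fibre F)"
      by (rule connectedin_continuous_map_image[OF contf connectedin_fibre[OF F]])
    ultimately show ?thesis
      using connectedin_clopen_cases[OF _ closedin_fibre openin_fibre] by blast
  qed
  have proj: "snd ` f A = h (snd ` A)" if "A \<in> HP" for A
  proof -
    have "A \<in> fibre (snd ` A)" using that by (simp add: fibre_def)
    then have "f A \<in> fibre (h (snd ` A))"
      using image_fibre[OF snd_image_in_hyperspace[OF that]] by blast
    then show ?thesis by (simp add: fibre_def)
  qed
  have sec: "{x0} \<times> F \<in> HP" if "F \<in> HL" for F
    by (rule section_in_hyperspace[OF x0 that])
  have hHL: "h F \<in> HL" if "F \<in> HL" for F
    unfolding h_def by (rule snd_image_in_hyperspace[OF fHP[OF sec[OF that]]])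
  have "nonexpansive HL (hausdorff_dist dL) h"
    unfolding nonexpansive_def
  proof (intro conjI ballI)
    fix F G assume FG: "F \<in> HL" "G \<in> HL"
    have "hausdorff_dist dL (h F) (h G) \<le> hausdorff_dist D (f ({x0} \<times> F)) (f ({x0} \<times> G))"
      unfolding h_def using hausdorff_dist_snd_image_le fHP sec FG by blast
    also have "\<dots> \<le> hausdorff_dist D ({x0} \<times> F) ({x0} \<times> G)"
      by (rule f_le[OF sec[OF FG(1)] sec[OF FG(2)]])
    also have "\<dots> \<le> hausdorff_dist dL F G"
      by (rule hausdorff_dist_section_le[OF x0 FG])
    finally show "hausdorff_dist dL (h F) (h G) \<le> hausdorff_dist dL F G" .
  qed (use hHL in auto)
  moreover have "inj_on h HL"
  proof (rule inj_onI)
    fix F G assume F: "F \<in> HL" and G: "G \<in> HL" and eq: "h F = h G"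
    let ?H = "h F"
    let ?X = "subtopology HP.mtopology (fibre ?H)"
    define \<F> where "\<F> = (\<lambda>E. f ` fibre E) ` {E \<in> HL. h E = ?H}"
    have topX: "topspace ?X = fibre ?H"
      using fibre_subset by auto
    have "f ` fibre F = f ` fibre G"
    proof (rule Sierpinski_countable_closed_partition[where X = ?X and \<F> = \<F>])
      show "compact_space ?X"
        by (rule compact_space_subtopology[OF compactin_fibre[OF hHL[OF F]]])
      show "Hausdorff_space ?X"
        by (rule Hausdorff_space_subtopology[OF HP.Hausdorff_space_mtopology])
      show "connected_space ?X"
        using connectedin_fibre[OF hHL[OF F]] by (simp add: connectedin_def)
      show "countable \<F>"
        unfolding \<F>_def
        by (rule countable_image, rule countable_subset[OF _ countable_hyperspace_L]) auto
      show "\<forall>A\<in>\<F>. closedin ?X A"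
      proof
        fix A assume "A \<in> \<F>"
        then obtain E where E: "E \<in> HL" "h E = ?H" "A = f ` fibre E" by (auto simp: \<F>_def)
        have "compactin HP.mtopology A"
          unfolding E(3) by (rule image_compactin[OF compactin_fibre[OF E(1)] contf])
        then have "closedin HP.mtopology A"
          by (rule compactin_imp_closedin[OF HP.Hausdorff_space_mtopology])
        moreover have "A \<subseteq> fibre ?H"
          using image_fibre[OF E(1)] E(2,3) by simp
        ultimately show "closedin ?X A"
          by (simp add: closedin_subset_topspace)
      qed
      show "pairwise disjnt \<F>"
      proof (rule pairwiseI)
        fix A B assume "A \<in> \<F>" "B \<in> \<F>" "A \<noteq> B"
        then obtain E E' where E: "A = f ` fibre E" "B = f ` fibre E'" "E \<noteq> E'"
          by (auto simp: \<F>_def)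
        then have "fibre E \<inter> fibre E' = {}" by (auto simp: fibre_def)
        then have "A \<inter> B = {}"
          unfolding E using inj_on_image_Int[OF bij_betw_imp_inj_on[OF bij] fibre_subset fibre_subset]
          by (metis image_empty)
        then show "disjnt A B" by (simp add: disjnt_def)
      qed
      show "topspace ?X \<subseteq> \<Union>\<F>"
        unfolding topX
      proof
        fix B assume B: "B \<in> fibre ?H"
        then have "B \<in> f ` HP"
          using fibre_subset bij_betw_imp_surj_on[OF bij] by blast
        then obtain A where A: "A \<in> HP" "B = f A" by blast
        have "h (snd ` A) = ?H"
          using proj[OF A(1)] A(2) B by (simp add: fibre_def)
        moreover have "B \<in> f ` fibre (snd ` A)"
          using A by (auto simp: fibre_def)
        ultimately show "B \<in> \<Union>\<F>"
          unfolding \<F>_def using snd_image_in_hyperspace[OF A(1)] by blast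
      qed
      show "f ` fibre F \<in> \<F>" "f ` fibre G \<in> \<F>"
        using F G eq by (auto simp: \<F>_def)
      show "f ` fibre F \<noteq> {}" "f ` fibre G \<noteq> {}"
        using fibre_nonempty F G by auto
    qed
    then have "fibre F = fibre G"
      by (simp only: inj_on_image_eq_iff[OF bij_betw_imp_inj_on[OF bij] fibre_subset fibre_subset])
    moreover obtain A where "A \<in> fibre F"
      using fibre_nonempty[OF F] by blast
    ultimately show "F = G"
      unfolding fibre_def by blast
  qed
  moreover have "h ` HL = HL"
  proof
    show "HL \<subseteq> h ` HL"
    proof
      fix F assume "F \<in> HL"
      then have "{x0} \<times> F \<in> f ` HP"
        using sec bij_betw_imp_surj_on[OF bij] by blast
      then obtain A where A: "{x0} \<times> F = f A" "A \<in> HP" by (rule imageE)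
      then have "F = h (snd ` A)"
        using proj[OF A(2)] by (simp flip: A(1))
      then show "F \<in> h ` HL"
        using snd_image_in_hyperspace[OF A(2)] by blast
    qed
  qed (use hHL in auto)
  ultimately show thesis
    using that[of h] proj by (simp add: bij_betw_def)
qed

text \<open>The hypothesis on nonexpansive bijections of the hyperspace of \<open>L\<close> describes them up to an isometry
  \<open>g\<close> of \<open>L\<close>.  This isometry is undone by relabelling the second coordinate with \<open>\<psi> = g\<^sup>-\<^sup>1\<close>, which is again a
  nonexpansive bijection of the hyperspace of the product.\<close>

lemma relabel_in_hyperspace:
  assumes \<psi>: "isometry L dL \<psi>" and A: "A \<in> HP"
  shows "map_prod id \<psi> ` A \<in> HP"
proof -
  have cont: "continuous_map P.mtopology P.mtopology (map_prod id \<psi>)"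
    by (rule nonexpansive_imp_continuous_map[OF P.Metric_space_axioms P.Metric_space_axioms])
      (use \<psi> in \<open>auto simp: isometry_def sup_dist_eq\<close>)
  have "compactin P.mtopology (map_prod id \<psi> ` A)"
    by (rule image_compactin[OF _ cont]) (use A in \<open>simp add: hyperspace_def\<close>)
  then show ?thesis
    using A by (simp add: hyperspace_def)
qed

lemma hausdorff_dist_relabel_le:
  assumes \<psi>: "isometry L dL \<psi>" and A: "A \<in> HP" and B: "B \<in> HP"
  shows "hausdorff_dist D (map_prod id \<psi> ` A) (map_prod id \<psi> ` B) \<le> hausdorff_dist D A B"
proof -
  have D_eq: "D (map_prod id \<psi> p) (map_prod id \<psi> q) = D p q" if "p \<in> K \<times> L" "q \<in> K \<times> L" for p q
    using \<psi> that by (auto simp: isometry_def sup_dist_eq)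
  have sub: "A \<subseteq> K \<times> L" "B \<subseteq> K \<times> L"
    using A B P.hyperspace_subset by auto
  have side: "\<forall>p'\<in>map_prod id \<psi> ` A. \<exists>q'\<in>map_prod id \<psi> ` B. D p' q' \<le> r"
    if sub: "A \<subseteq> K \<times> L" "B \<subseteq> K \<times> L" and near: "\<forall>p\<in>A. \<exists>q\<in>B. D p q \<le> r" for A B r
  proof
    fix p' assume "p' \<in> map_prod id \<psi> ` A"
    then obtain p where p: "p' = map_prod id \<psi> p" "p \<in> A" by (rule imageE)
    obtain q where q: "q \<in> B" "D p q \<le> r" using bspec[OF near p(2)] by (rule bexE)
    have "D p' (map_prod id \<psi> q) = D p q"
      unfolding p(1) by (rule D_eq) (use p(2) q(1) sub in auto)
    then have "D p' (map_prod id \<psi> q) \<le> r" using q(2) by simp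
    then show "\<exists>q'\<in>map_prod id \<psi> ` B. D p' q' \<le> r"
      using q(1) by blast
  qed
  have near: "\<forall>p\<in>A. \<exists>q\<in>B. D p q \<le> hausdorff_dist D A B"
    "\<forall>q\<in>B. \<exists>p\<in>A. D q p \<le> hausdorff_dist D A B"
    using P.hausdorff_dist_le_iff[OF A B] by blast+
  show ?thesis
    unfolding P.hausdorff_dist_le_iff[OF relabel_in_hyperspace[OF \<psi> A] relabel_in_hyperspace[OF \<psi> B]]
    using side[OF sub near(1)] side[OF sub(2,1) near(2)] by (rule conjI)
qed

lemma isometry_inv_into:
  assumes g: "bij_betw g L L" "isometry L dL g"
  shows "isometry L dL (inv_into L g)"
  unfolding isometry_def
proof (intro conjI ballI)
  show inv_in: "inv_into L g \<in> L \<rightarrow> L"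
    using bij_betwE[OF bij_betw_inv_into[OF g(1)]] by auto
  show "dL (inv_into L g u) (inv_into L g v) = dL u v" if "u \<in> L" "v \<in> L" for u v
  proof -
    have "dL (g (inv_into L g u)) (g (inv_into L g v)) = dL (inv_into L g u) (inv_into L g v)"
      using g(2) inv_in that by (simp add: isometry_def Pi_iff)
    then show ?thesis
      using bij_betw_inv_into_right[OF g(1)] that by simp
  qed
qed

lemma bij_betw_relabel:
  assumes g: "bij_betw g L L" "isometry L dL g"
  shows "bij_betw ((`) (map_prod id (inv_into L g))) HP HP"
proof (rule bij_betw_byWitness[where f' = "(`) (map_prod id g)"])
  show "(`) (map_prod id (inv_into L g)) ` HP \<subseteq> HP" "(`) (map_prod id g) ` HP \<subseteq> HP"
    using relabel_in_hyperspace isometry_inv_into[OF g] g(2) by auto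
  have cancel: "map_prod id \<phi> ` map_prod id \<psi> ` A = A"
    if A: "A \<in> HP" and "\<And>u. u \<in> L \<Longrightarrow> \<phi> (\<psi> u) = u" for A \<phi> \<psi>
  proof -
    have "map_prod id \<phi> (map_prod id \<psi> p) = p" if "p \<in> A" for p
      using P.hyperspace_subset[OF A] that \<open>\<And>u. u \<in> L \<Longrightarrow> \<phi> (\<psi> u) = u\<close> by (cases p) auto
    then show ?thesis by (simp add: image_image)
  qed
  show "\<forall>A\<in>HP. map_prod id g ` map_prod id (inv_into L g) ` A = A"
    using cancel bij_betw_inv_into_right[OF g(1)] by blast
  show "\<forall>A\<in>HP. map_prod id (inv_into L g) ` map_prod id g ` A = A"
    using cancel bij_betw_inv_into_left[OF g(1)] by blast
qed

text \<open>The assumption on \<open>E\<close> says that, up to the isometry \<open>g\<close>, the map \<open>h\<close> permutes the nonempty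
  subsets of \<open>E\<close>.  After undoing \<open>g\<close>, the map \<open>f\<close> therefore permutes the compact subsets of
  \<open>K \<times> E\<close>.  These form a compact hyperspace, where a nonexpansive bijection is isometric.  Undoing
  \<open>g\<close> does not increase distances, so \<open>f\<close> cannot have decreased them.\<close>

lemma isometric_on_hyperspace_Times_finite:
  assumes bij: "bij_betw f HP HP" and ne: "nonexpansive HP (hausdorff_dist D) f"
    and h: "bij_betw h HL HL" and proj: "\<And>A. A \<in> HP \<Longrightarrow> snd ` f A = h (snd ` A)"
    and g: "bij_betw g L L" "isometry L dL g"
    and E: "finite E" "E \<subseteq> L"
    and hE: "h ` hyperspace_of_subset L dL E = hyperspace_of_subset L dL (g ` E)"
    and A: "A \<in> HP" "A \<subseteq> K \<times> E" and B: "B \<in> HP" "B \<subseteq> K \<times> E"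
  shows "hausdorff_dist D (f A) (f B) = hausdorff_dist D A B"
proof -
  let ?S = "hyperspace_of_subset (K \<times> L) D (K \<times> E)"
  let ?g' = "inv_into L g"
  define f' where "f' = (`) (map_prod id ?g') \<circ> f"
  have bij': "bij_betw f' HP HP"
    unfolding f'_def by (rule bij_betw_trans[OF bij bij_betw_relabel[OF g]])
  have fHP: "f A \<in> HP" if "A \<in> HP" for A
    using bij that by (auto dest: bij_betwE)
  have f'HP: "f' A \<in> HP" if "A \<in> HP" for A
    using bij' that by (auto dest: bij_betwE)
  have f_le: "hausdorff_dist D (f A) (f B) \<le> hausdorff_dist D A B" if "A \<in> HP" "B \<in> HP" for A B
    using ne that by (simp add: nonexpansive_def)
  have f'_le_f: "hausdorff_dist D (f' A) (f' B) \<le> hausdorff_dist D (f A) (f B)"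
    if "A \<in> HP" "B \<in> HP" for A B
    unfolding f'_def comp_apply
    by (rule hausdorff_dist_relabel_le[OF isometry_inv_into[OF g] fHP[OF that(1)] fHP[OF that(2)]])
  have in_S: "A \<in> ?S \<longleftrightarrow> snd ` A \<subseteq> E" if "A \<in> HP" for A
    using that P.hyperspace_subset[OF that] by (auto simp: hyperspace_of_subset_def mem_Times_iff)
  have snd_f': "snd ` f' A = ?g' ` h (snd ` A)" if "A \<in> HP" for A
  proof -
    have "snd ` f' A = ?g' ` snd ` f A"
      by (simp add: f'_def image_image)
    then show ?thesis using proj[OF that] by simp
  qed
  have preserves: "f' A \<in> ?S \<longleftrightarrow> A \<in> ?S" if AP: "A \<in> HP" for A
  proof -
    have F: "snd ` A \<in> HL" "h (snd ` A) \<in> HL"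
      using snd_image_in_hyperspace[OF AP] h by (auto dest: bij_betwE)
    have "f' A \<in> ?S \<longleftrightarrow> ?g' ` h (snd ` A) \<subseteq> E"
      using in_S[OF f'HP[OF AP]] snd_f'[OF AP] by simp
    also have "\<dots> \<longleftrightarrow> h (snd ` A) \<subseteq> g ` E"
    proof
      assume "?g' ` h (snd ` A) \<subseteq> E"
      then have "g ` ?g' ` h (snd ` A) \<subseteq> g ` E" by (rule image_mono)
      moreover have "g ` ?g' ` h (snd ` A) = h (snd ` A)"
        by (rule bij_betw_imp_surj_on[OF g(1), THEN image_inv_into_cancel, OF L.hyperspace_subset[OF F(2)]])
      ultimately show "h (snd ` A) \<subseteq> g ` E" by simp
    next
      assume "h (snd ` A) \<subseteq> g ` E"
      then have "?g' ` h (snd ` A) \<subseteq> ?g' ` g ` E" by (rule image_mono)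
      moreover have "?g' ` g ` E = E"
        by (rule inv_into_image_cancel[OF bij_betw_imp_inj_on[OF g(1)] E(2)])
      ultimately show "?g' ` h (snd ` A) \<subseteq> E" by simp
    qed
    also have "\<dots> \<longleftrightarrow> h (snd ` A) \<in> h ` hyperspace_of_subset L dL E"
      unfolding hE using F(2) by (simp add: hyperspace_of_subset_def)
    also have "\<dots> \<longleftrightarrow> snd ` A \<in> hyperspace_of_subset L dL E"
      by (rule inj_on_image_mem_iff[OF bij_betw_imp_inj_on[OF h] F(1)])
        (auto simp: hyperspace_of_subset_def)
    also have "\<dots> \<longleftrightarrow> A \<in> ?S"
      using in_S[OF AP] F(1) by (simp add: hyperspace_of_subset_def)
    finally show ?thesis .
  qed
  have S_HP: "?S \<subseteq> HP" by (auto simp: hyperspace_of_subset_def)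
  have bijS: "bij_betw f' ?S ?S"
  proof (rule bij_betw_subset[OF bij' S_HP])
    show "f' ` ?S = ?S"
    proof
      show "f' ` ?S \<subseteq> ?S" using preserves S_HP by blast
      show "?S \<subseteq> f' ` ?S"
      proof
        fix C assume C: "C \<in> ?S"
        then have "C \<in> f' ` HP"
          using S_HP bij_betw_imp_surj_on[OF bij'] by blast
        then obtain A where "C = f' A" "A \<in> HP" by (rule imageE)
        then show "C \<in> f' ` ?S" using preserves C by blast
      qed
    qed
  qed
  have tb: "HP.mtotally_bounded ?S"
    by (rule HP.compactin_imp_mtotally_bounded[OF P.compactin_hyperspace_of_subset[OF
            compactin_Times_finite[OF E]]])
  have "P.hyperdist (f' A) (f' B) = P.hyperdist A B"
  proof (rule HP.nonexpansive_bij_isometric_if_mtotally_bounded[OF tb bijS])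
    fix A B assume "A \<in> ?S" "B \<in> ?S"
    then have AB: "A \<in> HP" "B \<in> HP" using S_HP by auto
    have "hausdorff_dist D (f' A) (f' B) \<le> hausdorff_dist D A B"
      using f'_le_f[OF AB] f_le[OF AB] by linarith
    then show "P.hyperdist (f' A) (f' B) \<le> P.hyperdist A B"
      using AB f'HP by simp
  qed (use A B in \<open>simp_all add: hyperspace_of_subset_def\<close>)
  then have "hausdorff_dist D (f' A) (f' B) = hausdorff_dist D A B"
    using A(1) B(1) f'HP by simp
  then show ?thesis
    using f'_le_f[OF A(1) B(1)] f_le[OF A(1) B(1)] by linarith
qed

end

theorem theorem5p5:
  fixes K :: "'a set" and dK :: "'a \<Rightarrow> 'a \<Rightarrow> real"
    and L :: "'b set" and dL :: "'b \<Rightarrow> 'b \<Rightarrow> real"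
  assumes "Metric_space K dK"
    and "compact_space (Metric_space.mtopology K dK)"
    and "connected_space (Metric_space.mtopology K dK)"
    and "Metric_space L dL"
    and P1_separated: "\<forall>u\<in>L. \<forall>v\<in>L. u \<noteq> v \<longrightarrow> dL u v \<ge> 1"
    and P1_bounded: "\<forall>S. S \<subseteq> L \<and> Metric_space.mbounded L dL S \<longrightarrow> finite S"
    and P2: "\<forall>h. bij_betw h (hyperspace L dL) (hyperspace L dL) \<and>
        nonexpansive (hyperspace L dL) (hausdorff_dist dL) h \<longrightarrow>
        (\<exists>g Ln. bij_betw g L L \<and> isometry L dL g \<and>
          (\<forall>n\<ge>1::nat. Ln n \<noteq> {} \<and> finite (Ln n) \<and> Ln n \<subseteq> Ln (Suc n)) \<and>
          (\<Union>n\<in>{1..}. Ln n) = L \<and>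
          (\<forall>n\<ge>1. h ` hyperspace_of_subset L dL (Ln n) = hyperspace_of_subset L dL (g ` Ln n)))"
  shows "plastic (hyperspace (K \<times> L) (sup_dist dK dL)) (hausdorff_dist (sup_dist dK dL))"
proof (cases "K = {}")
  (* Fibres over the finite subsets of L are nonempty only if K has a point. *)
  case True
  interpret P: Metric_space "K \<times> L" "sup_dist dK dL"
    using assms(1,4) by (rule Metric_space_sup_dist)
  have "A \<notin> hyperspace (K \<times> L) (sup_dist dK dL)" for A
    using P.hyperspace_subset[of A] P.hyperspace_nonempty[of A] True by auto
  then have "hyperspace (K \<times> L) (sup_dist dK dL) = {}" by blast
  then show ?thesis by (simp add: plastic_def isometry_def)
next
  case False
  interpret K: Metric_space K dK by fact
  interpret L: Metric_space L dL by fact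
  interpret continuum_times_discrete K dK L dL
  proof
    show "finite S" if "L.mbounded S" for S
      using P1_bounded L.mbounded_subset_mspace[OF that] that by blast
  qed (use assms False in auto)
  show ?thesis
    unfolding plastic_def
  proof (intro allI impI)
    fix f assume f: "bij_betw f HP HP \<and> nonexpansive HP (hausdorff_dist D) f"
    then obtain h where h: "bij_betw h HL HL" "nonexpansive HL (hausdorff_dist dL) h"
      and proj: "\<And>A. A \<in> HP \<Longrightarrow> snd ` f A = h (snd ` A)"
      using nonexpansive_bij_induces_base_bij by blast
    obtain g Ln where g: "bij_betw g L L" "isometry L dL g"
      and Ln: "\<forall>n\<ge>1::nat. Ln n \<noteq> {} \<and> finite (Ln n) \<and> Ln n \<subseteq> Ln (Suc n)"
      and cover: "(\<Union>n\<in>{1..}. Ln n) = L"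
      and hLn: "\<forall>n\<ge>1. h ` hyperspace_of_subset L dL (Ln n) = hyperspace_of_subset L dL (g ` Ln n)"
      using P2[rule_format, OF conjI[OF h]] by auto
    (* The sets Ln n are only constrained from n = 1 on, hence the shift of the index. *)
    have mono: "incseq (\<lambda>n. Ln (Suc n))"
      using Ln by (intro incseq_SucI) simp
    have absorb: "\<exists>n. F \<subseteq> Ln (Suc n)" if "finite F" "F \<subseteq> L" for F
      using that
    proof (induction F rule: finite_induct)
      case (insert u F)
      then obtain n where n: "F \<subseteq> Ln (Suc n)" by auto
      obtain m where m: "m \<ge> 1" "u \<in> Ln m" using insert.prems cover by auto
      then have "u \<in> Ln (Suc (m - 1))" by simp
      then have "insert u F \<subseteq> Ln (Suc (max n (m - 1)))"
        using n incseqD[OF mono, of n "max n (m - 1)"] incseqD[OF mono, of "m - 1" "max n (m - 1)"]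
        by auto
      then show ?case ..
    qed simp
    show "isometry HP (hausdorff_dist D) f"
      unfolding isometry_def
    proof (intro conjI ballI)
      show "f \<in> HP \<rightarrow> HP" using f by (simp add: nonexpansive_def)
      fix A B assume A: "A \<in> HP" and B: "B \<in> HP"
      have "finite (snd ` A \<union> snd ` B)" "snd ` A \<union> snd ` B \<subseteq> L"
        using snd_image_in_hyperspace[OF A] snd_image_in_hyperspace[OF B] hyperspace_L_iff by auto
      then obtain n where n: "snd ` A \<union> snd ` B \<subseteq> Ln (Suc n)"
        using absorb by blast
      have E: "finite (Ln (Suc n))" "Ln (Suc n) \<subseteq> L"
        using Ln cover by auto
      have sub: "A \<subseteq> K \<times> Ln (Suc n)" "B \<subseteq> K \<times> Ln (Suc n)"
        using n P.hyperspace_subset[OF A] P.hyperspace_subset[OF B]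
        by (auto simp: mem_Times_iff)
      show "hausdorff_dist D (f A) (f B) = hausdorff_dist D A B"
        using isometric_on_hyperspace_Times_finite[OF conjunct1[OF f] conjunct2[OF f] h(1) proj g E
            _ A sub(1) B sub(2)] hLn by simp
    qed
  qed
qed

end
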